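(* For all non-zero integers $m$ (and indeed for all non-zero real numbers $m$), $$6m^2-1+K_{n=1}^{\infty}\frac{m^2(4n^2+2n)}{m^2(4n^2+10n+6)-1}=\frac{1}{\frac1m\csc\left(\frac1m\right)-1}.$$
   Context: For sequences $\{a_n\}_{n\ge1}$, $\{b_n\}_{n\ge1}$, $K_{n=1}^{N}\frac{a_n}{b_n}$ denotes the finite continued fraction $\cfrac{a_1}{b_1+\cfrac{a_2}{b_2+\cdots+\cfrac{a_N}{b_N}}}$, written as $A_N/B_N$, where $A_{-1}=1$, $A_0=0$, $B_{-1}=0$, $B_0=1$, and $A_n=b_nA_{n-1}+a_nA_{n-2}$, $B_n=b_nB_{n-1}+a_nB_{n-2}$ for $n\ge1$. $K_{n=1}^{\infty}\frac{a_n}{b_n}$ denotes $\lim_{N\to\infty}A_N/B_N$, if the limit exists.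
   Formalization: For real m with sin(1/m) = 0, that is m = 1/(kπ) with k a nonzero integer, csc(1/m) is undefined; there the right-hand side is read as 0, its limiting value. For every other nonzero m the identity is stated as written. *)

theory Defs
  imports Complex_Main
begin

(* Numerators A_n and denominators B_n of the continued fraction
   a 1 / (b 1 + a 2 / (b 2 + ...)).  The values A_(-1) = 1 and B_(-1) = 0 occur only in the
   step n = 1, where they are written out; a 0 and b 0 are never used. *)

fun cf_num :: "(nat \<Rightarrow> 'a::field) \<Rightarrow> (nat \<Rightarrow> 'a) \<Rightarrow> nat \<Rightarrow> 'a" where
  "cf_num a b 0 = 0"
| "cf_num a b (Suc 0) = b 1 * 0 + a 1 * 1"
| "cf_num a b (Suc (Suc n)) =
     b (Suc (Suc n)) * cf_num a b (Suc n) + a (Suc (Suc n)) * cf_num a b n"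

fun cf_den :: "(nat \<Rightarrow> 'a::field) \<Rightarrow> (nat \<Rightarrow> 'a) \<Rightarrow> nat \<Rightarrow> 'a" where
  "cf_den a b 0 = 1"
| "cf_den a b (Suc 0) = b 1 * 1 + a 1 * 0"
| "cf_den a b (Suc (Suc n)) =
     b (Suc (Suc n)) * cf_den a b (Suc n) + a (Suc (Suc n)) * cf_den a b n"

definition cf_convergent :: "(nat \<Rightarrow> real) \<Rightarrow> (nat \<Rightarrow> real) \<Rightarrow> bool" where
  "cf_convergent a b \<longleftrightarrow>
     (\<forall>\<^sub>F N in sequentially. cf_den a b N \<noteq> 0) \<and>
     convergent (\<lambda>N. cf_num a b N / cf_den a b N)"

(* Only meaningful under cf_convergent: the eventual non-vanishing of the denominators
   ensures that the convention x / 0 = 0 does not influence the limit. *)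
definition cf_lim :: "(nat \<Rightarrow> real) \<Rightarrow> (nat \<Rightarrow> real) \<Rightarrow> real" where
  "cf_lim a b = lim (\<lambda>N. cf_num a b N / cf_den a b N)"

(* At the zeros of sin this yields the junk value 0 instead of a pole. *)
definition csc :: "real \<Rightarrow> real" where
  "csc x = 1 / sin x"

end

(* With d n = m^2 (2n+2)(2n+3) the partial quotients are a n = d (n-1) and b n = d n - 1, so the
   recurrence for a sequence X of numerators or denominators reads
   X n - d n X (n-1) = - (X (n-1) - d (n-1) X (n-2)) and telescopes.  Dividing by the product of
   the d i turns the denominators into the partial sums of the series of 6 (x - sin x) / x^3 at
   x = 1/m (Euler's correspondence between series and continued fractions). *)
theory Submission
  imports Defs
begin

text \<open>The defect \<open>X (Suc n) - d (Suc n) * X n\<close> of any solution of the recurrence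
  only changes sign at each step. For the denominators it starts at
  \<open>b 1 - d 1 = -1\<close>.\<close>

lemma cf_den_Suc_diff:
  fixes a b d :: "nat \<Rightarrow> 'a::field"
  assumes "\<And>n. a (Suc n) = d n" "\<And>n. b (Suc n) = d (Suc n) - 1"
  shows "cf_den a b (Suc n) = d (Suc n) * cf_den a b n + (-1) ^ Suc n"
proof (induction n)
  case 0
  show ?case using assms(2)[of 0] by simp
next
  case (Suc n)
  then have "(-1) ^ Suc n = cf_den a b (Suc n) - d (Suc n) * cf_den a b n" by simp
  then show ?case by (simp add: assms algebra_simps)
qed

text \<open>The same sign alternation as for the denominators; the initial defect is now
  \<open>a 1 = d 0\<close>.\<close>

lemma cf_num_Suc_diff:
  fixes a b d :: "nat \<Rightarrow> 'a::field"
  assumes "\<And>n. a (Suc n) = d n" "\<And>n. b (Suc n) = d (Suc n) - 1"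
  shows "cf_num a b (Suc n) = d (Suc n) * cf_num a b n - d 0 * (-1) ^ Suc n"
proof (induction n)
  case 0
  show ?case using assms(1)[of 0] by simp
next
  case (Suc n)
  then have "d 0 * (-1) ^ Suc n = d (Suc n) * cf_num a b n - cf_num a b (Suc n)" by simp
  then show ?case by (simp add: assms algebra_simps)
qed

lemma cf_den_eq_prod_sum:
  fixes a b d :: "nat \<Rightarrow> 'a::field"
  assumes "\<And>n. a (Suc n) = d n" "\<And>n. b (Suc n) = d (Suc n) - 1"
    and nz: "\<And>n. d (Suc n) \<noteq> 0"
  shows "cf_den a b n = (\<Prod>i<n. d (Suc i)) * (\<Sum>k\<le>n. (-1) ^ k / (\<Prod>i<k. d (Suc i)))"
proof (induction n)
  case 0
  show ?case by simp
next
  case (Suc n)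
  have "(\<Prod>i<n. d (Suc i)) \<noteq> 0" using nz by simp
  then show ?case
    using Suc nz[of n] by (simp add: cf_den_Suc_diff[where d = d, OF assms(1,2)] field_simps)
qed

text \<open>In \<open>cf_num + d 0 * cf_den\<close> the alternating defects cancel, so each step
  just multiplies by the next \<open>d\<close>, starting from \<open>d 0\<close>.\<close>

lemma cf_num_eq_prod_minus_den:
  fixes a b d :: "nat \<Rightarrow> 'a::field"
  assumes "\<And>n. a (Suc n) = d n" "\<And>n. b (Suc n) = d (Suc n) - 1"
  shows "cf_num a b n = d 0 * ((\<Prod>i<n. d (Suc i)) - cf_den a b n)"
proof (induction n)
  case 0
  show ?case by simp
next
  case (Suc n)
  show ?case
    by (simp add: cf_num_Suc_diff[where d = d, OF assms] cf_den_Suc_diff[where d = d, OF assms]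
        Suc algebra_simps)
qed

lemma cf_tendsto:
  fixes a b d :: "nat \<Rightarrow> real"
  assumes rec: "\<And>n. a (Suc n) = d n" "\<And>n. b (Suc n) = d (Suc n) - 1"
    and nz: "\<And>n. d (Suc n) \<noteq> 0"
    and sums: "(\<lambda>k. (-1) ^ k / (\<Prod>i<k. d (Suc i))) sums S" and "S \<noteq> 0"
  shows "cf_convergent a b" "cf_lim a b = d 0 * (1 / S - 1)"
proof -
  define P where "P n = (\<Prod>i<n. d (Suc i))" for n
  define T where "T n = (\<Sum>k\<le>n. (-1) ^ k / P k)" for n
  have Pnz: "P n \<noteq> 0" for n using nz by (simp add: P_def)
  have den: "cf_den a b n = P n * T n" for n
    unfolding P_def T_def by (rule cf_den_eq_prod_sum) (use rec nz in auto)
  have num: "cf_num a b n = d 0 * (P n - cf_den a b n)" for n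
    unfolding P_def by (rule cf_num_eq_prod_minus_den) (use rec in auto)
  have T: "T \<longlonglongrightarrow> S"
    using sums unfolding sums_def_le T_def P_def .
  \<comment> \<open>This is where \<open>S\<close> being non-zero matters: it keeps the denominators
    \<open>P n * T n\<close> away from 0 eventually, so \<open>P n\<close> cancels and each
    convergent becomes \<open>d 0 * (1 / T n - 1)\<close>.\<close>
  have ev: "\<forall>\<^sub>F n in sequentially. T n \<noteq> 0"
    using tendsto_imp_eventually_ne[OF T \<open>S \<noteq> 0\<close>] .
  have "(\<lambda>n. d 0 * (1 / T n - 1)) \<longlonglongrightarrow> d 0 * (1 / S - 1)"
    by (intro tendsto_intros T \<open>S \<noteq> 0\<close>)
  moreover have "\<forall>\<^sub>F n in sequentially.
      d 0 * (1 / T n - 1) = cf_num a b n / cf_den a b n"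
    using ev by eventually_elim (use Pnz in \<open>simp add: num den field_simps\<close>)
  ultimately have lim: "(\<lambda>n. cf_num a b n / cf_den a b n) \<longlonglongrightarrow> d 0 * (1 / S - 1)"
    by (rule Lim_transform_eventually)
  have "\<forall>\<^sub>F n in sequentially. cf_den a b n \<noteq> 0"
    using ev by eventually_elim (simp add: den Pnz)
  then show "cf_convergent a b"
    using lim unfolding cf_convergent_def by (auto intro: convergentI)
  show "cf_lim a b = d 0 * (1 / S - 1)"
    unfolding cf_lim_def using lim by (rule limI)
qed

lemma sums_diff_sin:
  fixes x :: real
  shows "(\<lambda>k. (-1) ^ k * x ^ (2 * k + 3) / fact (2 * k + 3)) sums (x - sin x)"
proof -
  \<comment> \<open>The sine series without its leading term \<open>x\<close>.\<close>
  have "(\<lambda>n. (-1) ^ Suc n / fact (2 * Suc n + 1) * x ^ (2 * Suc n + 1)) sums (sin x - x)"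
    using sin_paired[of x] by (subst sums_Suc_iff) simp
  from sums_minus[OF this] show ?thesis
    by (simp add: numeral_3_eq_3)
qed

text \<open>Apart from the powers of \<open>c\<close> the factors are 4 * 5, 6 * 7, and so on up to
  \<open>(2 * k + 2) * (2 * k + 3)\<close>; the missing 3! accounts for the 6.\<close>

lemma prod_eq_fact_odd:
  fixes c :: real
  shows "(\<Prod>i<k. c * (2 * real (Suc i) + 2) * (2 * real (Suc i) + 3)) = c ^ k * fact (2 * k + 3) / 6"
proof (induction k)
  case 0
  show ?case by (simp add: fact_numeral)
next
  case (Suc k)
  have "(fact (2 * Suc k + 3) :: real) = (2 * real k + 5) * ((2 * real k + 4) * fact (2 * k + 3))"
  proof -
    have "2 * Suc k + 3 = Suc (Suc (2 * k + 3))" by simp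
    then show ?thesis by (simp only: fact_Suc) (simp add: algebra_simps)
  qed
  moreover have "(\<Prod>i<Suc k. c * (2 * real (Suc i) + 2) * (2 * real (Suc i) + 3))
      = c ^ k * fact (2 * k + 3) / 6 * (c * (2 * real (Suc k) + 2) * (2 * real (Suc k) + 3))"
    by (simp only: prod.lessThan_Suc Suc)
  ultimately show ?case by (simp only:) (simp add: algebra_simps)
qed

text \<open>Needed for a non-zero series sum. By the half-angle formula, equality would force
  \<open>cos (x / 2)\<close> to have modulus 1, hence \<open>sin (x / 2) = 0\<close> and then
  \<open>x = sin x = 0\<close>.\<close>

lemma sin_neq_self:
  fixes x :: real
  assumes "x \<noteq> 0"
  shows "sin x \<noteq> x"
proof
  assume eq: "sin x = x"
  have "sin x = 2 * sin (x / 2) * cos (x / 2)" using sin_double[of "x / 2"] by simp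
  then have "\<bar>x\<bar> = \<bar>2 * sin (x / 2) * cos (x / 2)\<bar>" using eq by simp
  also have "\<dots> = 2 * \<bar>sin (x / 2)\<bar> * \<bar>cos (x / 2)\<bar>" by (simp only: abs_mult abs_numeral)
  also have "\<dots> \<le> \<bar>x\<bar> * \<bar>cos (x / 2)\<bar>"
    using abs_sin_x_le_abs_x[of "x / 2"] by (intro mult_right_mono) auto
  finally have "1 \<le> \<bar>cos (x / 2)\<bar>" using assms by simp
  then have "\<bar>cos (x / 2)\<bar> = 1" using abs_cos_le_one[of "x / 2"] by linarith
  then have "(cos (x / 2))\<^sup>2 = 1" by (metis power2_abs one_power2)
  then have "sin (x / 2) = 0" using sin_cos_squared_add[of "x / 2"] by simp
  then show False using eq assms \<open>sin x = 2 * sin (x / 2) * cos (x / 2)\<close> by simp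
qed

lemma csc_quotient_eq:
  fixes x :: real
  assumes "sin x \<noteq> 0"
  shows "1 / (x * csc x - 1) = sin x / (x - sin x)"
proof -
  have "x * csc x - 1 = (x - sin x) / sin x"
    using assms by (simp add: csc_def field_simps)
  then show ?thesis by simp
qed

lemma csc_continued_fraction:
  fixes m :: real
  assumes m: "m \<noteq> 0"
  defines "a \<equiv> \<lambda>n. m^2 * (4 * (real n)^2 + 2 * real n)"
    and "b \<equiv> \<lambda>n. m^2 * (4 * (real n)^2 + 10 * real n + 6) - 1"
  shows "cf_convergent a b"
    "6 * m^2 - 1 + cf_lim a b
      = (if sin (1 / m) = 0 then 0 else 1 / (1 / m * csc (1 / m) - 1))"
proof -
  define d where "d n = m^2 * (2 * real n + 2) * (2 * real n + 3)" for n
  define x where "x = 1 / m"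
  \<comment> \<open>Equals 6 (x - sin x) / x^3, since \<open>m = 1 / x\<close>; the 6 comes from the
    3! in \<open>prod_eq_fact_odd\<close>.\<close>
  define S where "S = 6 * m ^ 3 * (x - sin x)"
  have x: "x \<noteq> 0" using m by (simp add: x_def)
  have d_nz: "d n \<noteq> 0" for n using m by (simp add: d_def add_eq_0_iff)
  have S: "S \<noteq> 0" using m sin_neq_self[OF x] by (simp add: S_def)
  have rec: "a (Suc n) = d n" "b (Suc n) = d (Suc n) - 1" for n
    by (simp_all add: a_def b_def d_def algebra_simps power2_eq_square)
  have "(-1) ^ k / (\<Prod>i<k. d (Suc i)) = 6 * m ^ 3 * ((-1) ^ k * x ^ (2 * k + 3) / fact (2 * k + 3))"
    for k
    unfolding d_def prod_eq_fact_odd x_def using m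
    by (simp add: power_add power_one_over field_simps flip: power_mult)
  then have sums: "(\<lambda>k. (-1) ^ k / (\<Prod>i<k. d (Suc i))) sums S"
    unfolding S_def by (simp only: sums_mult[OF sums_diff_sin])
  show "cf_convergent a b"
    by (rule cf_tendsto(1)[where d = d, OF rec d_nz sums S])
  have "cf_lim a b = d 0 * (1 / S - 1)"
    by (rule cf_tendsto(2)[where d = d, OF rec d_nz sums S])
  also have "d 0 = 6 * m ^ 2" by (simp add: d_def)
  finally have "6 * m ^ 2 - 1 + cf_lim a b = 6 * m ^ 2 / S - 1" by (simp add: algebra_simps)
  also have "6 * m ^ 2 / S = x / (x - sin x)"
    using m by (simp add: S_def x_def power2_eq_square power3_eq_cube)
  also have "x / (x - sin x) - 1 = sin x / (x - sin x)"
    using sin_neq_self[OF x] by (simp add: field_simps)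
  \<comment> \<open>The quotient on the left is the true value and vanishes with
    \<open>sin x\<close>. There the convention \<open>csc x = 0\<close> would give -1 instead, hence
    the case split.\<close>
  also have "\<dots> = (if sin x = 0 then 0 else 1 / (x * csc x - 1))"
    by (simp add: csc_quotient_eq)
  finally show "6 * m^2 - 1 + cf_lim a b
      = (if sin (1 / m) = 0 then 0 else 1 / (1 / m * csc (1 / m) - 1))"
    by (simp only: x_def)
qed

text \<open>Since \<open>1 / m\<close> lies strictly between \<open>- pi\<close> and
  \<open>pi\<close>, where 0 is the only zero of \<open>sin\<close>, the pole of \<open>csc\<close>
  never occurs for integers.\<close>

lemma sin_inverse_int_neq_0:
  fixes m :: int
  assumes "m \<noteq> 0"
  shows "sin (1 / real_of_int m) \<noteq> 0"
proof -
  have "\<bar>1 / real_of_int m\<bar> \<le> 1" using assms by simp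
  then have "- pi < 1 / real_of_int m" "1 / real_of_int m < pi" using pi_ge_two by linarith+
  then show ?thesis using assms sin_eq_0_pi[of "1 / real_of_int m"] by auto
qed

theorem corollary7:
  shows "(\<forall>m::int. m \<noteq> 0 \<longrightarrow>
      cf_convergent (\<lambda>n. (of_int m)^2 * (4 * (real n)^2 + 2 * real n))
                    (\<lambda>n. (of_int m)^2 * (4 * (real n)^2 + 10 * real n + 6) - 1) \<and>
      6 * (of_int m)^2 - 1
        + cf_lim (\<lambda>n. (of_int m)^2 * (4 * (real n)^2 + 2 * real n))
                 (\<lambda>n. (of_int m)^2 * (4 * (real n)^2 + 10 * real n + 6) - 1)
      = 1 / (1 / of_int m * csc (1 / of_int m) - 1))
   \<and> (\<forall>m::real. m \<noteq> 0 \<longrightarrow>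
      cf_convergent (\<lambda>n. m^2 * (4 * (real n)^2 + 2 * real n))
                    (\<lambda>n. m^2 * (4 * (real n)^2 + 10 * real n + 6) - 1) \<and>
      6 * m^2 - 1
        + cf_lim (\<lambda>n. m^2 * (4 * (real n)^2 + 2 * real n))
                 (\<lambda>n. m^2 * (4 * (real n)^2 + 10 * real n + 6) - 1)
      = (if sin (1 / m) = 0 then 0 \<comment> \<open>pole of csc: 1 / \<infinity> = 0\<close>
         else 1 / (1 / m * csc (1 / m) - 1)))"
proof (intro conjI allI impI, goal_cases)
  case (1 m)
  then show ?case by (intro csc_continued_fraction) simp
next
  case (2 m)
  then show ?case
    using csc_continued_fraction(2)[of "of_int m"] sin_inverse_int_neq_0[of m] by simp
next
  case (3 m)
  then show ?case by (rule csc_continued_fraction)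
next
  case (4 m)
  then show ?case by (rule csc_continued_fraction)
qed

end
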